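(* Let $X$ be a topological space. Then the convergence space $[X,\$]$ is core compact, so that $[[X,\$],\$]$ is topological. More specifically, $[[X,\$],\$]$ can be identified with the space $\kappa(X)$ endowed with the Stone topology: identifying the continuous maps $[X,\$]\to\$$ with the $[X,\$]$-open subsets of $\mathcal{O}_X$, that is, with the elements of $\kappa(X)$, the convergence of $[[X,\$],\$]$ is the convergence of the Stone topology on $\kappa(X)$.
   Context: A convergence $\xi$ on a set $X$ is a relation between $X$ and the set $\mathbb{F}X$ of (proper) filters on $X$, written $x\in\lim_\xi\mathcal{F}$, such that $x\in\lim_\xi\{x\}^{\uparrow}$ for every $x$ (where $\{x\}^\uparrow$ is the principal ultrafilter of $x$) and $\lim_\xi\mathcal{F}\subseteq\lim_\xi\mathcal{G}$ whenever $\mathcal{F}\subseteq\mathcal{G}$. A topological space is regarded as a convergence space by $x\in\lim\mathcal{F}$ iff $\mathcal{F}$ contains the neighborhood filter of $x$; a convergence arising this way is called topological. A subset $O$ of a convergence space is open if $O\in\mathcal{F}$ whenever $\lim\mathcal{F}\cap O\neq\emptyset$. A map $f$ is continuous if $x\in\lim\mathcal{F}$ implies $f(x)\in\lim f(\mathcal{F})$. For convergence spaces $X,Y$, $[X,Y]$ is the set $C(X,Y)$ of continuous maps endowed with the continuous convergence: $f\in\lim_{[X,Y]}\mathcal{F}$ iff for every $x\in X$ and every filter $\mathcal{G}$ with $x\in\lim_X\mathcal{G}$, $f(x)\in\lim_Y e(\mathcal{G}\times\mathcal{F})$, where $e(x,f)=f(x)$. $\$$ is the Sierpiński space $\{0,1\}$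 with open sets $\emptyset,\{1\},\{0,1\}$. Continuous maps $X\to\$$ are identified (via indicator functions) with open subsets of $X$; $\mathcal{O}_X$ denotes the set of open subsets of $X$. For $X$ topological, $[X,\$]$ is thus the convergence on $\mathcal{O}_X$ given by $U\in\lim\mathcal{F}$ iff $U\subseteq\bigcup_{F\in\mathcal{F}}\operatorname{int}\left(\bigcap_{O\in F}O\right)$. Adherence: $\operatorname{adh}\mathcal{F}$ is the union of $\lim\mathcal{H}$ over all filters $\mathcal{H}$ that mesh with $\mathcal{F}$ (i.e. $H\cap F\ne\emptyset$ for all $H\in\mathcal{H},F\in\mathcal{F}$). A subset $A$ is compact at a subset $B$ if $\operatorname{adh}\mathcal{F}\cap B\neq\emptyset$ for every filter $\mathcal{F}$ all of whose elements meet $A$. A convergence space is core compact if whenever $x\in\lim\mathcal{F}$, there is a filter $\mathcal{G}\subseteq\mathcal{F}$ with $x\in\lim\mathcal{G}$ such that for every $G\in\mathcal{G}$ there is $G'\in\mathcal{G}$ that is compact at $G$. For $X$ topological, $\kappa(X)$ is the set of openly isotone compact families on $X$: families $\mathcal{A}\subseteq\mathcal{O}_X$ such that every open superset of an element of $\mathcal{A}$ is in $\mathcal{A}$, and whenever $\bigcup_{i\in I}O_i\in\mathcal{A}$ with each $O_i$ open, there is a finite $J\subseteq I$ with $\bigcup_{i\in J}O_i\in\mathcal{A}$. These are exactly the $[X,\$]$-open subsets of $\mathcal{O}_X$. The Stone topology on $\kappa(X)$ is the topology with subbase $\{U^{+}:U\in\mathcal{O}_X\}$, where $U^{+}:=\{\mathcal{A}\in\kappa(X):U\in\mathcal{A}\}$.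 *)

theory Defs
  imports "HOL-Analysis.Analysis"
begin

text \<open>
  A proper filter on a set \<open>X\<close> is encoded as a library filter \<open>F\<close> on the ambient type with
  \<open>F \<noteq> bot\<close> and \<open>F \<le> principal X\<close>; a subset \<open>A\<close> of \<open>X\<close> belongs to it iff
  \<open>\<forall>\<^sub>F x in F. x \<in> A\<close>. The library order is reversed inclusion: \<open>G \<le> F\<close> means that every
  element of \<open>F\<close> is an element of \<open>G\<close>.
\<close>

definition filter_on :: "'a set \<Rightarrow> 'a filter \<Rightarrow> bool" where
  "filter_on X F \<longleftrightarrow> F \<noteq> bot \<and> F \<le> principal X"

abbreviation in_filter :: "'a set \<Rightarrow> 'a filter \<Rightarrow> bool" where
  "in_filter A F \<equiv> eventually (\<lambda>x. x \<in> A) F"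

text \<open>
  The limit function is total on the type of filters; it is normalized to be empty on those
  that are not proper filters on the carrier, so that equality of records is equality of
  convergence spaces.
\<close>

record 'a convergence =
  cpoints :: "'a set"
  clim :: "'a filter \<Rightarrow> 'a set"

definition convergence_space :: "'a convergence \<Rightarrow> bool" where
  "convergence_space Z \<longleftrightarrow>
     (\<forall>F. clim Z F \<subseteq> cpoints Z) \<and>
     (\<forall>F. \<not> filter_on (cpoints Z) F \<longrightarrow> clim Z F = {}) \<and>
     (\<forall>x\<in>cpoints Z. x \<in> clim Z (principal {x})) \<and>
     (\<forall>F G. filter_on (cpoints Z) F \<and> filter_on (cpoints Z) G \<and> G \<le> F \<longrightarrow> clim Z F \<subseteq> clim Z G)"

definition conv_of_topology :: "'a topology \<Rightarrow> 'a convergence" where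
  "conv_of_topology T =
     \<lparr>cpoints = topspace T,
      clim = (\<lambda>F. {x \<in> topspace T. filter_on (topspace T) F \<and> F \<le> nhdsin T x})\<rparr>"

definition topological_conv :: "'a convergence \<Rightarrow> bool" where
  "topological_conv Z \<longleftrightarrow> (\<exists>T. Z = conv_of_topology T)"

definition conv_open :: "'a convergence \<Rightarrow> 'a set \<Rightarrow> bool" where
  "conv_open Z W \<longleftrightarrow> W \<subseteq> cpoints Z \<and>
     (\<forall>F. filter_on (cpoints Z) F \<and> clim Z F \<inter> W \<noteq> {} \<longrightarrow> in_filter W F)"

definition conv_continuous :: "'a convergence \<Rightarrow> 'b convergence \<Rightarrow> ('a \<Rightarrow> 'b) \<Rightarrow> bool" where
  "conv_continuous Z Y f \<longleftrightarrow> f \<in> cpoints Z \<rightarrow> cpoints Y \<and>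
     (\<forall>F x. filter_on (cpoints Z) F \<and> x \<in> clim Z F \<longrightarrow> f x \<in> clim Y (filtermap f F))"

text \<open>Maps are normalized to be \<^const>\<open>undefined\<close> outside the carrier.\<close>

definition cont_maps :: "'a convergence \<Rightarrow> 'b convergence \<Rightarrow> ('a \<Rightarrow> 'b) set" where
  "cont_maps Z Y = {f \<in> extensional (cpoints Z). conv_continuous Z Y f}"

definition cont_conv :: "'a convergence \<Rightarrow> 'b convergence \<Rightarrow> ('a \<Rightarrow> 'b) convergence" where
  "cont_conv Z Y =
     \<lparr>cpoints = cont_maps Z Y,
      clim = (\<lambda>F. {f \<in> cont_maps Z Y. filter_on (cont_maps Z Y) F \<and>
        (\<forall>x\<in>cpoints Z. \<forall>G. filter_on (cpoints Z) G \<and> x \<in> clim Z G \<longrightarrow>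
           f x \<in> clim Y (filtermap (\<lambda>(z, g). g z) (G \<times>\<^sub>F F)))})\<rparr>"

definition conv_homeomorphism :: "'a convergence \<Rightarrow> 'b convergence \<Rightarrow> ('a \<Rightarrow> 'b) \<Rightarrow> bool" where
  "conv_homeomorphism Z Y h \<longleftrightarrow> bij_betw h (cpoints Z) (cpoints Y) \<and>
     (\<forall>F. filter_on (cpoints Z) F \<longrightarrow>
        (\<forall>x\<in>cpoints Z. x \<in> clim Z F \<longleftrightarrow> h x \<in> clim Y (filtermap h F)))"

definition mesh :: "'a filter \<Rightarrow> 'a filter \<Rightarrow> bool" where
  "mesh H F \<longleftrightarrow> (\<forall>A B. in_filter A H \<and> in_filter B F \<longrightarrow> A \<inter> B \<noteq> {})"

definition adherence :: "'a convergence \<Rightarrow> 'a filter \<Rightarrow> 'a set" where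
  "adherence Z F = (\<Union>H \<in> {H. filter_on (cpoints Z) H \<and> mesh H F}. clim Z H)"

definition compact_at :: "'a convergence \<Rightarrow> 'a set \<Rightarrow> 'a set \<Rightarrow> bool" where
  "compact_at Z A B \<longleftrightarrow>
     (\<forall>F. filter_on (cpoints Z) F \<and> (\<forall>S. in_filter S F \<longrightarrow> S \<inter> A \<noteq> {}) \<longrightarrow>
        adherence Z F \<inter> B \<noteq> {})"

definition core_compact :: "'a convergence \<Rightarrow> bool" where
  "core_compact Z \<longleftrightarrow>
     (\<forall>F x. filter_on (cpoints Z) F \<and> x \<in> clim Z F \<longrightarrow>
        (\<exists>G. filter_on (cpoints Z) G \<and> F \<le> G \<and> x \<in> clim Z G \<and>
          (\<forall>A\<subseteq>cpoints Z. in_filter A G \<longrightarrow>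
             (\<exists>A'\<subseteq>cpoints Z. in_filter A' G \<and> compact_at Z A' A))))"

text \<open>The points 0 and 1 are represented by \<^const>\<open>False\<close> and \<^const>\<open>True\<close>.\<close>

definition sierpinski :: "bool topology" where
  "sierpinski = topology (\<lambda>U. U \<in> {{}, {True}, {False, True}})"

abbreviation dual :: "'a convergence \<Rightarrow> ('a \<Rightarrow> bool) convergence" where
  "dual Z \<equiv> cont_conv Z (conv_of_topology sierpinski)"

text \<open>
  The subset whose indicator function is \<open>f\<close>. This is the identification of the points of
  \<^term>\<open>dual Z\<close> with the open subsets of \<open>Z\<close>.
\<close>

definition indicated :: "'a convergence \<Rightarrow> ('a \<Rightarrow> bool) \<Rightarrow> 'a set" where
  "indicated Z f = {x \<in> cpoints Z. f x}"

definition kappa :: "'a topology \<Rightarrow> 'a set set set" where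
  "kappa X = {\<A>. \<A> \<subseteq> {U. openin X U} \<and>
     (\<forall>U V. U \<in> \<A> \<and> openin X V \<and> U \<subseteq> V \<longrightarrow> V \<in> \<A>) \<and>
     (\<forall>\<U>. (\<forall>U\<in>\<U>. openin X U) \<and> \<Union>\<U> \<in> \<A> \<longrightarrow> (\<exists>\<V>\<subseteq>\<U>. finite \<V> \<and> \<Union>\<V> \<in> \<A>))}"

definition stone_plus :: "'a topology \<Rightarrow> 'a set \<Rightarrow> 'a set set set" where
  "stone_plus X U = {\<A> \<in> kappa X. U \<in> \<A>}"

text \<open>
  The whole space \<^term>\<open>kappa X\<close> is the empty intersection of subbasic sets. It has to be added
  explicitly because \<^const>\<open>topology_generated_by\<close> only takes the union of the subbase as
  carrier, and the empty family, a point of \<^term>\<open>kappa X\<close>, lies in no subbasic set.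
\<close>

definition stone_topology :: "'a topology \<Rightarrow> 'a set set topology" where
  "stone_topology X =
     topology_generated_by (insert (kappa X) {stone_plus X U | U. openin X U})"

text \<open>
  A point of the bidual is sent to the family of those open sets whose indicator functions
  it maps to \<^const>\<open>True\<close>.
\<close>

definition bidual_family :: "'a topology \<Rightarrow> (('a \<Rightarrow> bool) \<Rightarrow> bool) \<Rightarrow> 'a set set" where
  "bidual_family X \<phi> =
     indicated (conv_of_topology X) ` indicated (dual (conv_of_topology X)) \<phi>"

lemma openin_sierpinski: "openin sierpinski U \<longleftrightarrow> U \<in> {{}, {True}, {False, True}}"
proof -
  have "istopology (\<lambda>U. U \<in> {{}, {True}, {False, True}})"
  proof -
    have "U \<in> {{}, {True}, {False, True}} \<longleftrightarrow> (False \<in> U \<longrightarrow> True \<in> U)" for U :: "bool set"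
      by (cases "False \<in> U"; cases "True \<in> U") (auto, (metis (full_types))+)
    then show ?thesis
      unfolding istopology_def by (simp only:) blast
  qed
  then show ?thesis
    by (simp add: sierpinski_def topology_inverse')
qed

lemma topspace_sierpinski: "topspace sierpinski = UNIV"
  unfolding topspace_def openin_sierpinski by (auto simp: UNIV_bool)

lemma topspace_stone_topology: "topspace (stone_topology X) = kappa X"
  by (auto simp: stone_topology_def stone_plus_def)

lemma convergence_space_conv_of_topology: "convergence_space (conv_of_topology T)"
proof -
  have "principal {x} \<le> nhdsin T x" if "x \<in> topspace T" for x
    using that by (auto simp: le_filter_def eventually_principal eventually_nhdsin)
  then show ?thesis
    by (auto simp: convergence_space_def conv_of_topology_def filter_on_def principal_eq_bot_iff
        dest: order_trans)
qed

lemma filter_on_filtermap_eval: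
  assumes "filter_on A G" "filter_on (cont_maps Z Y) F" "A \<subseteq> cpoints Z"
  shows "filter_on (cpoints Y) (filtermap (\<lambda>(z, g). g z) (G \<times>\<^sub>F F))"
proof -
  have "in_filter A G" "in_filter (cont_maps Z Y) F"
    using assms by (auto simp: filter_on_def le_principal)
  then have "eventually (\<lambda>p. fst p \<in> A \<and> snd p \<in> cont_maps Z Y) (G \<times>\<^sub>F F)"
    by (auto simp: eventually_prod_filter)
  then have "eventually (\<lambda>p. (\<lambda>(z, g). g z) p \<in> cpoints Y) (G \<times>\<^sub>F F)"
    by (rule eventually_mono)
      (use assms(3) in \<open>fastforce simp: cont_maps_def conv_continuous_def Pi_iff\<close>)
  then show ?thesis
    using assms by (simp add: filter_on_def le_principal eventually_filtermap filtermap_bot_iff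
        prod_filter_eq_bot)
qed

lemma convergence_space_cont_conv:
  assumes "convergence_space Z" "convergence_space Y"
  shows "convergence_space (cont_conv Z Y)"
proof -
  have point: "f x \<in> clim Y (filtermap (\<lambda>(z, g). g z) (G \<times>\<^sub>F principal {f}))"
    if f: "f \<in> cont_maps Z Y" and G: "filter_on (cpoints Z) G" "x \<in> clim Z G" for f x G
  proof -
    have "filtermap (\<lambda>(z, g). g z) (G \<times>\<^sub>F principal {f}) = filtermap f G"
      by (simp add: prod_filter_principal_singleton2 filtermap_filtermap)
    then show ?thesis
      using f G by (auto simp: cont_maps_def conv_continuous_def)
  qed
  have mono: "f x \<in> clim Y (filtermap (\<lambda>(z, g). g z) (G \<times>\<^sub>F F'))"
    if "f x \<in> clim Y (filtermap (\<lambda>(z, g). g z) (G \<times>\<^sub>F F))" "filter_on (cpoints Z) G"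
      "filter_on (cont_maps Z Y) F" "filter_on (cont_maps Z Y) F'" "F' \<le> F" for f x F F' G
  proof -
    have "filtermap (\<lambda>(z, g). g z) (G \<times>\<^sub>F F') \<le> filtermap (\<lambda>(z, g). g z) (G \<times>\<^sub>F F)"
      using that by (intro filtermap_mono prod_filter_mono) auto
    moreover have "filter_on (cpoints Y) (filtermap (\<lambda>(z, g). g z) (G \<times>\<^sub>F F))"
      "filter_on (cpoints Y) (filtermap (\<lambda>(z, g). g z) (G \<times>\<^sub>F F'))"
      using that filter_on_filtermap_eval by blast+
    ultimately show ?thesis
      using assms(2) that(1) unfolding convergence_space_def by blast
  qed
  have "clim (cont_conv Z Y) F \<subseteq> clim (cont_conv Z Y) F'"
    if "filter_on (cont_maps Z Y) F" "filter_on (cont_maps Z Y) F'" "F' \<le> F" for F F'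
    using mono that unfolding cont_conv_def by fastforce
  moreover have "f \<in> clim (cont_conv Z Y) (principal {f})" if "f \<in> cont_maps Z Y" for f
    using point that by (auto simp: cont_conv_def filter_on_def principal_eq_bot_iff)
  ultimately show ?thesis
    unfolding convergence_space_def by (auto simp: cont_conv_def)
qed

end

theory Submission
  imports Defs
begin

text \<open>
  A point of \<open>[X,$]\<close> is an open set, and a filter on open sets converges to \<open>U\<close> iff every point
  of \<open>U\<close> has an open neighbourhood \<open>V\<close> such that the filter contains
  \<open>\<up>V = {O. V \<subseteq> O}\<close>, which is \<open>supersets X V\<close> (\<open>mem_clim_opens\<close>). Thus only the sets \<open>\<up>V\<close> matter
  for convergence. The open sets \<open>V\<close> whose \<open>\<up>V\<close> belongs to a given filter \<open>\<F>\<close> form a family closed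
  under finite unions, and this family covers every limit of \<open>\<F>\<close>; the filter with base all these
  \<open>\<up>V\<close> is coarser than \<open>\<F>\<close> and still converges to every open set that the family covers
  (\<open>clim_supersets_filter\<close>).

  \<^emph>\<open>Core compactness.\<close> The set \<open>\<up>V\<close> is compact at itself, because every filter that contains
  \<open>\<up>V\<close> converges to \<open>V \<in> \<up>V\<close> (\<open>compact_at_supersets\<close>). So the coarser filter above has a base of
  sets that are compact at themselves, and it witnesses core compactness.

  \<^emph>\<open>Open subsets.\<close> Applied to the family of finite unions of members of \<open>\<U>\<close>, the same computation
  shows that an \<open>[X,$]\<close>-open family that contains \<open>\<Union>\<U>\<close> also contains a finite union of members of
  \<open>\<U>\<close>. Conversely, a filter that converges to an element of a compact family contains \<open>\<up>V\<close> for
  some \<open>V\<close> in this family. So the \<open>[X,$]\<close>-open families are the elements of \<open>kappa X\<close>.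

  \<^emph>\<open>The bidual.\<close> Continuous convergence to \<open>\<A> \<in> kappa X\<close> on \<open>[[X,$],$]\<close> always implies pointwise
  convergence, which is convergence in the Stone topology, since it suffices to test the latter on
  the subbase. For the converse, the sets \<open>\<up>V\<close> again reduce the problem to single points: if a
  filter \<open>\<F>\<close> on \<open>[X,$]\<close> converges to an element of \<open>\<A>\<close>, then \<open>\<up>V\<close> belongs to \<open>\<F>\<close> for some
  \<open>V \<in> \<A>\<close> (\<open>kappa_clim_supersets\<close>). As the elements of \<open>kappa X\<close> are
  closed under open supersets, a family that contains \<open>V\<close> includes \<open>\<up>V\<close>, so testing
  convergence at the single point \<open>V\<close> controls it on \<open>\<up>V\<close> (\<open>clim_bidual\<close>).
\<close>

section \<open>The dual of a convergence space\<close>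

text \<open>
  The only neighbourhood of \<^const>\<open>False\<close> is the whole space, so that only convergence to
  \<^const>\<open>True\<close> is a condition.
\<close>

lemma mem_clim_sierpinski:
  "b \<in> clim (conv_of_topology sierpinski) K \<longleftrightarrow> K \<noteq> bot \<and> (b \<longrightarrow> eventually (\<lambda>c. c) K)"
proof -
  have "K \<le> nhdsin sierpinski b \<longleftrightarrow> (b \<longrightarrow> eventually (\<lambda>c. c) K)"
  proof (cases b)
    case True
    have "eventually P (nhdsin sierpinski True) \<longleftrightarrow> P True" for P
      by (auto simp: eventually_nhdsin openin_sierpinski topspace_sierpinski)
    then have "nhdsin sierpinski True = principal {True}"
      by (simp add: filter_eq_iff eventually_principal)
    then show ?thesis
      using True by (simp add: le_principal)
  next
    case False
    have "eventually P (nhdsin sierpinski False) \<longleftrightarrow> (\<forall>c. P c)" for P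
      by (auto simp: eventually_nhdsin openin_sierpinski topspace_sierpinski
          all_bool_eq UNIV_bool)
    then have "nhdsin sierpinski False = top"
      by (simp add: filter_eq_iff)
    then show ?thesis
      using False by simp
  qed
  then show ?thesis
    by (auto simp: conv_of_topology_def topspace_sierpinski filter_on_def)
qed

lemma cpoints_sierpinski: "cpoints (conv_of_topology sierpinski) = UNIV"
  by (simp add: conv_of_topology_def topspace_sierpinski)

lemma cpoints_conv_of_topology: "cpoints (conv_of_topology T) = topspace T"
  by (simp add: conv_of_topology_def)

lemma clim_conv_of_topology:
  "x \<in> clim (conv_of_topology T) F \<longleftrightarrow>
     x \<in> topspace T \<and> filter_on (topspace T) F \<and> F \<le> nhdsin T x"
  by (simp add: conv_of_topology_def)

lemma le_nhdsin_iff: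
  assumes "x \<in> topspace T"
  shows "F \<le> nhdsin T x \<longleftrightarrow> (\<forall>U. openin T U \<and> x \<in> U \<longrightarrow> in_filter U F)"
proof
  have "in_filter U (nhdsin T x)" if "openin T U" "x \<in> U" for U
    using that assms by (auto simp: eventually_nhdsin)
  then show "\<forall>U. openin T U \<and> x \<in> U \<longrightarrow> in_filter U F" if "F \<le> nhdsin T x"
    using that filter_leD by blast
  show "F \<le> nhdsin T x" if "\<forall>U. openin T U \<and> x \<in> U \<longrightarrow> in_filter U F"
    unfolding le_filter_def eventually_nhdsin using that assms
    by (metis (no_types, lifting) eventually_mono)
qed

lemma in_filter_carrier: "filter_on X F \<Longrightarrow> in_filter X F"
  by (simp add: filter_on_def le_principal)

lemma clim_subset_cpoints: "convergence_space Z \<Longrightarrow> x \<in> clim Z F \<Longrightarrow> x \<in> cpoints Z"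
  by (auto simp: convergence_space_def)

lemma conv_openD:
  assumes "convergence_space Z" "conv_open Z W" "x \<in> W" "x \<in> clim Z F"
  shows "in_filter W F"
  using assms unfolding convergence_space_def conv_open_def by blast

lemma mem_cpoints_dual:
  assumes Z: "convergence_space Z"
  shows "f \<in> cpoints (dual Z) \<longleftrightarrow> f \<in> extensional (cpoints Z) \<and> conv_open Z (indicated Z f)"
proof -
  have ev: "eventually f F \<longleftrightarrow> in_filter (indicated Z f) F" if "filter_on (cpoints Z) F" for F
    using in_filter_carrier[OF that] by (simp add: indicated_def eventually_conj_iff)
  have "conv_continuous Z (conv_of_topology sierpinski) f \<longleftrightarrow>
      (\<forall>F x. filter_on (cpoints Z) F \<and> x \<in> clim Z F \<and> f x \<longrightarrow> eventually f F)"
    by (auto simp: conv_continuous_def mem_clim_sierpinski eventually_filtermap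
        filtermap_bot_iff filter_on_def cpoints_sierpinski)
  also have "\<dots> \<longleftrightarrow> conv_open Z (indicated Z f)"
  proof -
    have "clim Z F \<inter> indicated Z f \<noteq> {} \<longleftrightarrow> (\<exists>x\<in>clim Z F. f x)" for F
      using clim_subset_cpoints[OF Z] by (auto simp: indicated_def)
    moreover have "indicated Z f \<subseteq> cpoints Z"
      by (auto simp: indicated_def)
    ultimately show ?thesis
      unfolding conv_open_def using ev by blast
  qed
  finally show ?thesis
    by (simp add: cont_conv_def cont_maps_def)
qed

text \<open>Points of the dual are normalized outside the carrier, which makes the following injective.\<close>

lemma bij_betw_indicated_dual:
  assumes "convergence_space Z"
  shows "bij_betw (indicated Z) (cpoints (dual Z)) {W. conv_open Z W}"
proof (rule bij_betwI[where g = "\<lambda>W. restrict (\<lambda>x. x \<in> W) (cpoints Z)"])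
  have *: "indicated Z (restrict (\<lambda>x. x \<in> W) (cpoints Z)) = W" if "conv_open Z W" for W
    using that by (auto simp: indicated_def conv_open_def)
  then show "(\<lambda>W. restrict (\<lambda>x. x \<in> W) (cpoints Z)) \<in> {W. conv_open Z W} \<rightarrow> cpoints (dual Z)"
    using assms by (auto simp: mem_cpoints_dual)
  show "indicated Z (restrict (\<lambda>x. x \<in> W) (cpoints Z)) = W" if "W \<in> {W. conv_open Z W}" for W
    using that * by blast
  show "indicated Z \<in> cpoints (dual Z) \<rightarrow> {W. conv_open Z W}"
    using assms by (simp add: mem_cpoints_dual)
  show "restrict (\<lambda>x. x \<in> indicated Z f) (cpoints Z) = f" if "f \<in> cpoints (dual Z)" for f
    using that assms by (auto simp: mem_cpoints_dual indicated_def extensional_def fun_eq_iff)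
qed

lemma mem_clim_dual:
  "f \<in> clim (dual Z) F \<longleftrightarrow>
     f \<in> cpoints (dual Z) \<and> filter_on (cpoints (dual Z)) F \<and>
     (\<forall>x\<in>indicated Z f. \<forall>G. filter_on (cpoints Z) G \<and> x \<in> clim Z G \<longrightarrow>
        eventually (\<lambda>(z, g). g z) (G \<times>\<^sub>F F))"
  by (auto simp: cont_conv_def mem_clim_sierpinski eventually_filtermap filtermap_bot_iff
      indicated_def prod_filter_eq_bot filter_on_def case_prod_unfold)

lemma convergence_space_dual: "convergence_space Z \<Longrightarrow> convergence_space (dual Z)"
  by (intro convergence_space_cont_conv convergence_space_conv_of_topology)

section \<open>The convergence on the open sets of a topological space\<close>

abbreviation opens :: "'a topology \<Rightarrow> ('a \<Rightarrow> bool) convergence" where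
  "opens X \<equiv> dual (conv_of_topology X)"

abbreviation set_of :: "'a topology \<Rightarrow> ('a \<Rightarrow> bool) \<Rightarrow> 'a set" where
  "set_of X \<equiv> indicated (conv_of_topology X)"

lemma conv_open_conv_of_topology: "conv_open (conv_of_topology X) W \<longleftrightarrow> openin X W"
proof
  assume W: "conv_open (conv_of_topology X) W"
  have "\<exists>V. openin X V \<and> x \<in> V \<and> V \<subseteq> W" if "x \<in> W" for x
  proof -
    have x: "x \<in> topspace X"
      using W that by (auto simp: conv_open_def cpoints_conv_of_topology)
    have "filter_on (topspace X) (nhdsin X x)"
      using x by (auto simp: filter_on_def le_principal trivial_limit_def eventually_nhdsin)
    then have "in_filter W (nhdsin X x)"
      using W that x
      by (force simp: conv_open_def cpoints_conv_of_topology clim_conv_of_topology)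
    then show ?thesis
      using x by (auto simp: eventually_nhdsin)
  qed
  then show "openin X W"
    by (subst openin_subopen) blast
next
  assume W: "openin X W"
  then show "conv_open (conv_of_topology X) W"
    using openin_subset[OF W]
    by (auto simp: conv_open_def cpoints_conv_of_topology clim_conv_of_topology le_nhdsin_iff)
qed

lemma convergence_space_opens: "convergence_space (opens X)"
  by (intro convergence_space_dual convergence_space_conv_of_topology)

lemma bij_betw_set_of: "bij_betw (set_of X) (cpoints (opens X)) {U. openin X U}"
  using bij_betw_indicated_dual[OF convergence_space_conv_of_topology, of X]
  by (simp add: conv_open_conv_of_topology)

lemma openin_set_of: "f \<in> cpoints (opens X) \<Longrightarrow> openin X (set_of X f)"
  using bij_betw_set_of[of X] by (auto simp: bij_betw_def)

lemma openin_obtain_point: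
  assumes "openin X U"
  obtains f where "f \<in> cpoints (opens X)" "set_of X f = U"
proof -
  have "U \<in> set_of X ` cpoints (opens X)"
    using assms bij_betw_imp_surj_on[OF bij_betw_set_of, of X] by simp
  with that show ?thesis
    by blast
qed

definition supersets :: "'a topology \<Rightarrow> 'a set \<Rightarrow> ('a \<Rightarrow> bool) set" where
  "supersets X V = {g \<in> cpoints (opens X). V \<subseteq> set_of X g}"

text \<open>
  Continuous convergence quantifies over all filters that converge to a point; the neighbourhood
  filter of the point is the critical one, and its open base turns the product filter into the
  condition on a single \<open>V\<close>.
\<close>

lemma mem_clim_opens:
  "f \<in> clim (opens X) F \<longleftrightarrow>
     f \<in> cpoints (opens X) \<and> filter_on (cpoints (opens X)) F \<and>
     (\<forall>x\<in>set_of X f. \<exists>V. openin X V \<and> x \<in> V \<and> in_filter (supersets X V) F)"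
proof -
  have "(\<forall>G. filter_on (topspace X) G \<and> x \<in> clim (conv_of_topology X) G \<longrightarrow>
            eventually (\<lambda>(z, g). g z) (G \<times>\<^sub>F F)) \<longleftrightarrow>
        (\<exists>V. openin X V \<and> x \<in> V \<and> in_filter (supersets X V) F)" (is "?L \<longleftrightarrow> ?R")
    if x: "x \<in> topspace X" and F: "filter_on (cpoints (opens X)) F" for x
  proof
    assume L: ?L
    have "filter_on (topspace X) (nhdsin X x)"
      using x by (auto simp: filter_on_def le_principal trivial_limit_def eventually_nhdsin)
    then have "eventually (\<lambda>(z, g). g z) (nhdsin X x \<times>\<^sub>F F)"
      using L x by (simp add: clim_conv_of_topology)
    then obtain P Q where P: "eventually P (nhdsin X x)" and Q: "eventually Q F"
      and PQ: "\<forall>z. P z \<longrightarrow> (\<forall>g. Q g \<longrightarrow> g z)"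
      by (auto simp: eventually_prod_filter)
    from P x obtain V where V: "openin X V" "x \<in> V" "\<forall>z\<in>V. P z"
      by (auto simp: eventually_nhdsin)
    have "in_filter (supersets X V) F"
      using Q in_filter_carrier[OF F]
    proof eventually_elim
      case (elim g)
      then show ?case
        using V PQ openin_subset[OF V(1)]
        by (auto simp: supersets_def indicated_def cpoints_conv_of_topology)
    qed
    with V show ?R
      by blast
  next
    assume ?R
    then obtain V where V: "openin X V" "x \<in> V" "in_filter (supersets X V) F"
      by blast
    have "eventually (\<lambda>(z, g). g z) (G \<times>\<^sub>F F)" if "x \<in> clim (conv_of_topology X) G" for G
    proof -
      have "in_filter V (nhdsin X x)"
        using V x by (auto simp: eventually_nhdsin)
      then have "in_filter V G"
        using that by (auto simp: clim_conv_of_topology dest: filter_leD)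
      with V(3) show ?thesis
        unfolding eventually_prod_filter
        by (intro exI[of _ "\<lambda>z. z \<in> V"] exI[of _ "\<lambda>g. g \<in> supersets X V"])
          (auto simp: supersets_def indicated_def)
    qed
    then show ?L
      by blast
  qed
  moreover have "set_of X f \<subseteq> topspace X"
    by (auto simp: indicated_def cpoints_conv_of_topology)
  ultimately show ?thesis
    unfolding mem_clim_dual cpoints_conv_of_topology by (meson subsetD)
qed

lemma supersets_Un: "supersets X (V \<union> W) = supersets X V \<inter> supersets X W"
  by (auto simp: supersets_def)

lemma supersets_empty: "supersets X {} = cpoints (opens X)"
  by (simp add: supersets_def)

section \<open>Filters with a base of supersets\<close>

definition supersets_filter :: "'a topology \<Rightarrow> 'a set set \<Rightarrow> ('a \<Rightarrow> bool) filter" where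
  "supersets_filter X \<V> = (INF V\<in>\<V>. principal (supersets X V))"

lemma in_supersets_filter:
  assumes "{} \<in> \<V>" "\<And>V W. V \<in> \<V> \<Longrightarrow> W \<in> \<V> \<Longrightarrow> V \<union> W \<in> \<V>"
  shows "in_filter A (supersets_filter X \<V>) \<longleftrightarrow> (\<exists>V\<in>\<V>. supersets X V \<subseteq> A)"
proof -
  have "eventually P (supersets_filter X \<V>) \<longleftrightarrow>
      (\<exists>V\<in>\<V>. eventually P (principal (supersets X V)))" for P
    unfolding supersets_filter_def
    using assms by (intro eventually_INF_base) (auto simp: supersets_Un[symmetric])
  then show ?thesis
    by (auto simp: eventually_principal)
qed

text \<open>
  For a family closed under finite unions, convergence can be read off the base: the filter is
  proper because \<open>V\<close> itself belongs to \<open>supersets X V\<close>.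
\<close>

lemma clim_supersets_filter:
  assumes \<V>: "{} \<in> \<V>" "\<And>V W. V \<in> \<V> \<Longrightarrow> W \<in> \<V> \<Longrightarrow> V \<union> W \<in> \<V>"
    and op: "\<And>V. V \<in> \<V> \<Longrightarrow> openin X V"
    and f: "f \<in> cpoints (opens X)" "set_of X f \<subseteq> \<Union>\<V>"
  shows "f \<in> clim (opens X) (supersets_filter X \<V>)"
proof -
  note ev = in_supersets_filter[OF \<V>]
  have "supersets X V \<noteq> {}" if V: "V \<in> \<V>" for V
  proof -
    obtain h where "h \<in> cpoints (opens X)" "set_of X h = V"
      using openin_obtain_point[OF op[OF V]] .
    then show ?thesis
      by (auto simp: supersets_def)
  qed
  then have "supersets_filter X \<V> \<noteq> bot"
    using ev[of "{}"] by (auto simp: trivial_limit_def)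
  moreover have "in_filter (cpoints (opens X)) (supersets_filter X \<V>)"
    using \<V>(1) supersets_empty[of X] by (subst ev) auto
  ultimately have "filter_on (cpoints (opens X)) (supersets_filter X \<V>)"
    by (simp add: filter_on_def le_principal)
  moreover have "\<exists>V. openin X V \<and> x \<in> V \<and> in_filter (supersets X V) (supersets_filter X \<V>)"
    if x: "x \<in> set_of X f" for x
  proof -
    obtain V where V: "V \<in> \<V>" "x \<in> V"
      using f(2) x by blast
    moreover have "in_filter (supersets X V) (supersets_filter X \<V>)"
      using V(1) by (subst ev) auto
    ultimately show ?thesis
      using op by blast
  qed
  ultimately show ?thesis
    using f(1) unfolding mem_clim_opens by blast
qed

text \<open>
  A filter that meshes with \<open>supersets X V\<close> has a refinement that contains this set. The refinement
  converges to \<open>V\<close>, because \<open>V\<close> serves as the required neighbourhood of each of its points.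
\<close>

lemma compact_at_supersets:
  assumes "openin X V" "supersets X V \<subseteq> A"
  shows "compact_at (opens X) (supersets X V) A"
  unfolding compact_at_def
proof (intro allI impI, elim conjE)
  fix F
  assume F: "filter_on (cpoints (opens X)) F"
    and meets: "\<forall>S. in_filter S F \<longrightarrow> S \<inter> supersets X V \<noteq> {}"
  define H where "H = inf F (principal (supersets X V))"
  have ev: "in_filter S H \<longleftrightarrow> in_filter {g. g \<in> supersets X V \<longrightarrow> g \<in> S} F" for S
    by (simp add: H_def eventually_inf_principal)
  have "H \<noteq> bot"
    using ev[of "{}"] meets by (fastforce simp: trivial_limit_def)
  then have H: "filter_on (cpoints (opens X)) H"
    using F by (auto simp: filter_on_def H_def intro: le_infI1)
  have HV: "in_filter (supersets X V) H"
    by (simp add: ev)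
  have "mesh H F"
    unfolding mesh_def
  proof (intro allI impI, elim conjE)
    fix A B
    assume "in_filter A H" "in_filter B F"
    then have "in_filter (A \<inter> B) H"
      using filter_leD[OF inf_le1, of "\<lambda>g. g \<in> B" F] by (simp add: H_def eventually_conj_iff)
    then show "A \<inter> B \<noteq> {}"
      using \<open>H \<noteq> bot\<close> by (metis empty_iff eventually_False eventually_mono)
  qed
  obtain h where h: "h \<in> cpoints (opens X)" "set_of X h = V"
    using openin_obtain_point[OF assms(1)] .
  then have "h \<in> clim (opens X) H"
    using H HV assms(1) unfolding mem_clim_opens by blast
  moreover have "h \<in> A"
    using h assms(2) by (auto simp: supersets_def)
  ultimately show "adherence (opens X) F \<inter> A \<noteq> {}"
    using H \<open>mesh H F\<close> by (auto simp: adherence_def)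
qed

theorem core_compact_opens: "core_compact (opens X)"
  unfolding core_compact_def
proof (intro allI impI, elim conjE)
  fix F f
  assume F: "filter_on (cpoints (opens X)) F" and f: "f \<in> clim (opens X) F"
  define \<V> where "\<V> = {V. openin X V \<and> in_filter (supersets X V) F}"
  have \<V>: "{} \<in> \<V>" "\<And>V W. V \<in> \<V> \<Longrightarrow> W \<in> \<V> \<Longrightarrow> V \<union> W \<in> \<V>"
    using in_filter_carrier[OF F]
    by (auto simp: \<V>_def supersets_empty supersets_Un eventually_conj_iff)
  note ev = in_supersets_filter[OF \<V>]
  have lim: "f \<in> clim (opens X) (supersets_filter X \<V>)"
    using \<V> f by (intro clim_supersets_filter) (auto simp: \<V>_def mem_clim_opens)
  have coarser: "F \<le> supersets_filter X \<V>"
    unfolding supersets_filter_def by (rule INF_greatest) (simp add: \<V>_def le_principal)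
  have "\<exists>A'\<subseteq>cpoints (opens X). in_filter A' (supersets_filter X \<V>) \<and> compact_at (opens X) A' A"
    if A: "in_filter A (supersets_filter X \<V>)" for A
  proof -
    obtain V where V: "V \<in> \<V>" "supersets X V \<subseteq> A"
      using A ev by blast
    then have "compact_at (opens X) (supersets X V) A"
      by (intro compact_at_supersets) (simp_all add: \<V>_def)
    moreover have "supersets X V \<subseteq> cpoints (opens X)"
      by (auto simp: supersets_def)
    moreover have "in_filter (supersets X V) (supersets_filter X \<V>)"
      using V(1) by (auto simp: ev)
    ultimately show ?thesis
      by blast
  qed
  moreover have "filter_on (cpoints (opens X)) (supersets_filter X \<V>)"
    using lim by (simp add: mem_clim_opens)
  ultimately show "\<exists>G. filter_on (cpoints (opens X)) G \<and> F \<le> G \<and> f \<in> clim (opens X) G \<and>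
      (\<forall>A\<subseteq>cpoints (opens X). in_filter A G \<longrightarrow>
         (\<exists>A'\<subseteq>cpoints (opens X). in_filter A' G \<and> compact_at (opens X) A' A))"
    using lim coarser by blast
qed

section \<open>Open families are the compact ones\<close>

lemma kappa_superset: "\<A> \<in> kappa X \<Longrightarrow> U \<in> \<A> \<Longrightarrow> openin X V \<Longrightarrow> U \<subseteq> V \<Longrightarrow> V \<in> \<A>"
  unfolding kappa_def by blast

lemma conv_open_upward_closed:
  assumes "conv_open (opens X) W" "f \<in> W" "g \<in> cpoints (opens X)" "set_of X f \<subseteq> set_of X g"
  shows "g \<in> W"
proof -
  have f: "f \<in> cpoints (opens X)"
    using assms by (auto simp: conv_open_def)
  \<comment> \<open>The larger set \<open>g\<close>, as a principal filter, converges to the smaller set \<open>f\<close>.\<close>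
  have "f \<in> clim (opens X) (principal {g})"
    using f assms(3,4) openin_set_of[OF f] unfolding mem_clim_opens
    by (auto simp: filter_on_def principal_eq_bot_iff eventually_principal supersets_def)
  then have "in_filter W (principal {g})"
    using conv_openD[OF convergence_space_opens] assms(1,2) by blast
  then show ?thesis
    by (simp add: eventually_principal)
qed

text \<open>
  Compactness is openness tested on one filter: the finite unions of members of \<open>\<U>\<close> generate a filter
  that converges to \<open>\<Union>\<U>\<close>, so that an open family containing \<open>\<Union>\<U>\<close> contains a member of its base.
\<close>

lemma conv_open_imp_kappa:
  assumes W: "conv_open (opens X) W"
  shows "set_of X ` W \<in> kappa X"
  unfolding kappa_def
proof (intro CollectI conjI allI impI; (elim conjE)?)
  have sub: "W \<subseteq> cpoints (opens X)"
    using W by (simp add: conv_open_def)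
  then show "set_of X ` W \<subseteq> {U. openin X U}"
    using openin_set_of by blast
  show "V \<in> set_of X ` W" if "U \<in> set_of X ` W" "openin X V" "U \<subseteq> V" for U V
  proof -
    obtain g where "g \<in> cpoints (opens X)" "set_of X g = V"
      using openin_obtain_point[OF \<open>openin X V\<close>] .
    with that conv_open_upward_closed[OF W] show ?thesis
      by blast
  qed
  show "\<exists>\<V>\<subseteq>\<U>. finite \<V> \<and> \<Union>\<V> \<in> set_of X ` W"
    if op: "\<forall>U\<in>\<U>. openin X U" and un: "\<Union>\<U> \<in> set_of X ` W" for \<U>
  proof -
    define \<V> where "\<V> = Union ` {\<B>. \<B> \<subseteq> \<U> \<and> finite \<B>}"
    have emp: "{} \<in> \<V>"
      by (auto simp: \<V>_def intro!: image_eqI[of _ _ "{}"])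
    have Un: "V \<union> V' \<in> \<V>" if VV': "V \<in> \<V>" "V' \<in> \<V>" for V V'
    proof -
      obtain \<B> \<B>' where "V = \<Union>\<B>" "V' = \<Union>\<B>'" "\<B> \<subseteq> \<U>" "\<B>' \<subseteq> \<U>" "finite \<B>" "finite \<B>'"
        using VV' by (auto simp: \<V>_def)
      then show ?thesis
        by (auto simp: \<V>_def intro!: image_eqI[of _ _ "\<B> \<union> \<B>'"])
    qed
    have cover: "\<Union>\<U> \<subseteq> \<Union>\<V>"
      by (force simp: \<V>_def intro: exI[of _ "{U}" for U])
    have \<V>_open: "openin X V" if "V \<in> \<V>" for V
      using that op by (auto simp: \<V>_def intro!: openin_Union)
    obtain f where f: "f \<in> W" "set_of X f = \<Union>\<U>"
      using un by auto
    have "f \<in> clim (opens X) (supersets_filter X \<V>)"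
      using f sub cover by (intro clim_supersets_filter emp Un \<V>_open) auto
    then have "in_filter W (supersets_filter X \<V>)"
      using conv_openD[OF convergence_space_opens W f(1)] by blast
    then obtain V where V: "V \<in> \<V>" "supersets X V \<subseteq> W"
      using in_supersets_filter[OF emp Un] by blast
    obtain h where "h \<in> cpoints (opens X)" "set_of X h = V"
      using openin_obtain_point[OF \<V>_open[OF V(1)]] .
    then have "V \<in> set_of X ` W"
      using V(2) by (auto simp: supersets_def)
    then show ?thesis
      using V(1) by (auto simp: \<V>_def)
  qed
qed

text \<open>
  For every point of \<open>U \<in> \<A>\<close>, convergence provides an open neighbourhood whose supersets form a
  member of the filter. Compactness of \<open>\<A>\<close> yields finitely many of these whose union is in \<open>\<A>\<close>, and the
  supersets of the union are the common supersets.
\<close>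

lemma kappa_clim_supersets:
  assumes \<A>: "\<A> \<in> kappa X" and f: "f \<in> clim (opens X) F" "set_of X f \<in> \<A>"
  obtains V where "V \<in> \<A>" "in_filter (supersets X V) F"
proof -
  define \<U> where "\<U> = {V. openin X V \<and> in_filter (supersets X V) F}"
  have F: "filter_on (cpoints (opens X)) F"
    using f by (simp add: mem_clim_opens)
  have "set_of X f \<subseteq> \<Union>\<U>"
    using f(1) by (auto simp: mem_clim_opens \<U>_def)
  moreover have "openin X (\<Union>\<U>)"
    by (auto simp: \<U>_def)
  ultimately have "\<Union>\<U> \<in> \<A>"
    using kappa_superset[OF \<A> f(2)] by blast
  moreover have "\<forall>U\<in>\<U>. openin X U"
    by (simp add: \<U>_def)
  ultimately obtain \<V> where \<V>: "\<V> \<subseteq> \<U>" "finite \<V>" "\<Union>\<V> \<in> \<A>"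
    using \<A> unfolding kappa_def by blast
  have "in_filter (supersets X (\<Union>\<V>)) F"
    using \<V>(2,1)
  proof induction
    case empty
    then show ?case
      using in_filter_carrier[OF F] by (simp add: supersets_empty)
  next
    case (insert V \<B>)
    then show ?case
      by (simp add: supersets_Un eventually_conj_iff \<U>_def)
  qed
  with \<V>(3) that show ?thesis
    by blast
qed

lemma kappa_imp_conv_open:
  assumes \<A>: "\<A> \<in> kappa X"
  shows "conv_open (opens X) {f \<in> cpoints (opens X). set_of X f \<in> \<A>}"
  unfolding conv_open_def
proof (intro conjI allI impI; (elim conjE)?)
  fix F
  assume "clim (opens X) F \<inter> {f \<in> cpoints (opens X). set_of X f \<in> \<A>} \<noteq> {}"
  then obtain f where "f \<in> clim (opens X) F" "set_of X f \<in> \<A>"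
    by blast
  then obtain V where V: "V \<in> \<A>" "in_filter (supersets X V) F"
    using kappa_clim_supersets[OF \<A>] by blast
  have "supersets X V \<subseteq> {f \<in> cpoints (opens X). set_of X f \<in> \<A>}"
    using kappa_superset[OF \<A> V(1)] openin_set_of unfolding supersets_def by blast
  with V(2) show "in_filter {f \<in> cpoints (opens X). set_of X f \<in> \<A>} F"
    by (auto elim: eventually_mono)
qed auto

theorem bij_betw_conv_open_kappa:
  "bij_betw (\<lambda>W. set_of X ` W) {W. conv_open (opens X) W} (kappa X)"
proof (rule bij_betwI[where g = "\<lambda>\<A>. {f \<in> cpoints (opens X). set_of X f \<in> \<A>}"])
  show "(\<lambda>W. set_of X ` W) \<in> {W. conv_open (opens X) W} \<rightarrow> kappa X"
    using conv_open_imp_kappa by blast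
  show "(\<lambda>\<A>. {f \<in> cpoints (opens X). set_of X f \<in> \<A>}) \<in> kappa X \<rightarrow> {W. conv_open (opens X) W}"
    using kappa_imp_conv_open by blast
  show "{f \<in> cpoints (opens X). set_of X f \<in> set_of X ` W} = W"
    if "W \<in> {W. conv_open (opens X) W}" for W
  proof -
    have "W \<subseteq> cpoints (opens X)"
      using that by (simp add: conv_open_def)
    then show ?thesis
      using inj_on_image_mem_iff[OF bij_betw_imp_inj_on[OF bij_betw_set_of[of X]]] by blast
  qed
  show "set_of X ` {f \<in> cpoints (opens X). set_of X f \<in> \<A>} = \<A>" if "\<A> \<in> kappa X" for \<A>
  proof -
    have "\<A> \<subseteq> set_of X ` cpoints (opens X)"
      using that bij_betw_imp_surj_on[OF bij_betw_set_of, of X] by (auto simp: kappa_def)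
    then show ?thesis
      by blast
  qed
qed

section \<open>The convergence of the bidual\<close>

lemma bij_betw_bidual_family: "bij_betw (bidual_family X) (cpoints (dual (opens X))) (kappa X)"
  using bij_betw_trans[OF bij_betw_indicated_dual[OF convergence_space_opens]
      bij_betw_conv_open_kappa, of X]
  by (simp add: bidual_family_def comp_def cong: bij_betw_cong)

lemma set_of_mem_bidual_family:
  assumes "f \<in> cpoints (opens X)"
  shows "set_of X f \<in> bidual_family X \<phi> \<longleftrightarrow> \<phi> f"
  using assms bij_betw_imp_inj_on[OF bij_betw_set_of, of X]
  by (auto simp: bidual_family_def indicated_def[of "opens X"] inj_on_def)

text \<open>
  Continuous convergence on the bidual is pointwise convergence. Pointwise convergence is tested
  on principal filters; conversely, a filter that converges to an element of the limit family
  contains the supersets of some member \<open>V\<close> of it, and these supersets belong to every member of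
  \<open>kappa X\<close> that contains \<open>V\<close>.
\<close>

theorem clim_bidual:
  assumes \<phi>: "\<phi> \<in> cpoints (dual (opens X))" and \<F>: "filter_on (cpoints (dual (opens X))) \<F>"
  shows "\<phi> \<in> clim (dual (opens X)) \<F> \<longleftrightarrow>
    (\<forall>U\<in>bidual_family X \<phi>. eventually (\<lambda>\<psi>. U \<in> bidual_family X \<psi>) \<F>)" (is "?L \<longleftrightarrow> ?R")
proof
  assume L: ?L
  show ?R
  proof
    fix U
    assume "U \<in> bidual_family X \<phi>"
    then obtain f where f: "f \<in> indicated (opens X) \<phi>" "U = set_of X f"
      by (auto simp: bidual_family_def)
    then have fX: "f \<in> cpoints (opens X)"
      by (simp add: indicated_def)
    then have "f \<in> clim (opens X) (principal {f})" "filter_on (cpoints (opens X)) (principal {f})"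
      using convergence_space_opens[of X]
      by (auto simp: convergence_space_def filter_on_def principal_eq_bot_iff)
    then have "eventually (\<lambda>(g, \<psi>). \<psi> g) (principal {f} \<times>\<^sub>F \<F>)"
      using L f(1) unfolding mem_clim_dual[of \<phi>] by blast
    then have "eventually (\<lambda>\<psi>. \<psi> f) \<F>"
      by (simp add: prod_filter_principal_singleton eventually_filtermap)
    then show "eventually (\<lambda>\<psi>. U \<in> bidual_family X \<psi>) \<F>"
      by (simp add: f(2) set_of_mem_bidual_family[OF fX])
  qed
next
  assume R: ?R
  have fam: "bidual_family X \<psi> \<in> kappa X" if "\<psi> \<in> cpoints (dual (opens X))" for \<psi>
    using that bij_betw_bidual_family[of X] by (auto simp: bij_betw_def)
  have "eventually (\<lambda>(g, \<psi>). \<psi> g) (G \<times>\<^sub>F \<F>)"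
    if f: "f \<in> indicated (opens X) \<phi>" "f \<in> clim (opens X) G" for f G
  proof -
    have "set_of X f \<in> bidual_family X \<phi>"
      using f(1) by (auto simp: bidual_family_def)
    then obtain V where V: "V \<in> bidual_family X \<phi>" "in_filter (supersets X V) G"
      using kappa_clim_supersets[OF fam[OF \<phi>] f(2)] by blast
    have up: "\<psi> g" if "\<psi> \<in> cpoints (dual (opens X))" "V \<in> bidual_family X \<psi>" "g \<in> supersets X V"
      for \<psi> g
    proof -
      have "g \<in> cpoints (opens X)" "V \<subseteq> set_of X g"
        using that(3) by (auto simp: supersets_def)
      then have "set_of X g \<in> bidual_family X \<psi>"
        using kappa_superset[OF fam[OF that(1)] that(2)] openin_set_of by blast
      then show ?thesis
        by (simp add: set_of_mem_bidual_family \<open>g \<in> cpoints (opens X)\<close>)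
    qed
    have "eventually (\<lambda>\<psi>. \<psi> \<in> cpoints (dual (opens X)) \<and> V \<in> bidual_family X \<psi>) \<F>"
      using R V(1) in_filter_carrier[OF \<F>] by (simp add: eventually_conj_iff)
    with V(2) up show ?thesis
      unfolding eventually_prod_filter
      by (intro exI[of _ "\<lambda>g. g \<in> supersets X V"]
          exI[of _ "\<lambda>\<psi>. \<psi> \<in> cpoints (dual (opens X)) \<and> V \<in> bidual_family X \<psi>"]) auto
  qed
  then show ?L
    using \<phi> \<F> unfolding mem_clim_dual[of \<phi>] by blast
qed

section \<open>Comparison with the Stone topology\<close>

text \<open>
  The sets in \<open>F\<close> are closed under finite intersections and supersets, so that the test on the
  subbase passes to every open set by induction on its generation.
\<close>

lemma le_nhdsin_topology_generated_by:
  assumes "x \<in> \<Union>S"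
  shows "F \<le> nhdsin (topology_generated_by S) x \<longleftrightarrow> (\<forall>U\<in>S. x \<in> U \<longrightarrow> in_filter U F)"
proof -
  have x: "x \<in> topspace (topology_generated_by S)"
    using assms by simp
  have "in_filter U F"
    if "generate_topology_on S U" "x \<in> U" "\<forall>U\<in>S. x \<in> U \<longrightarrow> in_filter U F" for U
    using that
  proof induction
    case (UN K)
    then obtain V where "V \<in> K" "in_filter V F"
      by blast
    then show ?case
      by (blast intro: eventually_mono)
  qed (auto simp: eventually_conj_iff)
  then show ?thesis
    unfolding le_nhdsin_iff[OF x] openin_topology_generated_by_iff
    by (blast intro: generate_topology_on.Basis)
qed

lemma le_nhdsin_stone_topology:
  assumes "\<A> \<in> kappa X" "in_filter (kappa X) F"
  shows "F \<le> nhdsin (stone_topology X) \<A> \<longleftrightarrow> (\<forall>U\<in>\<A>. eventually (\<lambda>\<B>. U \<in> \<B>) F)"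
proof -
  let ?S = "insert (kappa X) {stone_plus X U | U. openin X U}"
  have plus: "in_filter (stone_plus X U) F \<longleftrightarrow> eventually (\<lambda>\<B>. U \<in> \<B>) F" for U
    using assms(2) by (simp add: stone_plus_def eventually_conj_iff)
  have mem: "openin X U \<and> \<A> \<in> stone_plus X U \<longleftrightarrow> U \<in> \<A>" for U
    using assms(1) unfolding stone_plus_def kappa_def by blast
  have "F \<le> nhdsin (stone_topology X) \<A> \<longleftrightarrow> (\<forall>S\<in>?S. \<A> \<in> S \<longrightarrow> in_filter S F)"
    unfolding stone_topology_def using assms(1) by (intro le_nhdsin_topology_generated_by) blast
  also have "\<dots> \<longleftrightarrow> (\<forall>U. openin X U \<and> \<A> \<in> stone_plus X U \<longrightarrow> in_filter (stone_plus X U) F)"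
    using assms(2) by auto
  also have "\<dots> \<longleftrightarrow> (\<forall>U\<in>\<A>. eventually (\<lambda>\<B>. U \<in> \<B>) F)"
    unfolding plus using mem by blast
  finally show ?thesis .
qed

theorem bidual_homeomorphism:
  "conv_homeomorphism (dual (opens X)) (conv_of_topology (stone_topology X)) (bidual_family X)"
  unfolding conv_homeomorphism_def cpoints_conv_of_topology topspace_stone_topology
proof (intro conjI allI impI ballI bij_betw_bidual_family)
  fix \<F> \<phi>
  assume \<F>: "filter_on (cpoints (dual (opens X))) \<F>" and \<phi>: "\<phi> \<in> cpoints (dual (opens X))"
  have fam: "bidual_family X \<psi> \<in> kappa X" if "\<psi> \<in> cpoints (dual (opens X))" for \<psi>
    using that bij_betw_bidual_family[of X] by (auto simp: bij_betw_def)
  have K: "in_filter (kappa X) (filtermap (bidual_family X) \<F>)"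
    using in_filter_carrier[OF \<F>] fam by (auto simp: eventually_filtermap elim: eventually_mono)
  then have "filter_on (kappa X) (filtermap (bidual_family X) \<F>)"
    using \<F> by (simp add: filter_on_def le_principal filtermap_bot_iff)
  then show "\<phi> \<in> clim (dual (opens X)) \<F> \<longleftrightarrow>
      bidual_family X \<phi> \<in> clim (conv_of_topology (stone_topology X)) (filtermap (bidual_family X) \<F>)"
    by (simp add: clim_bidual[OF \<phi> \<F>] clim_conv_of_topology topspace_stone_topology fam[OF \<phi>]
        le_nhdsin_stone_topology[OF fam[OF \<phi>] K] eventually_filtermap)
qed

lemma le_nhdsin_pullback_topology:
  assumes "x \<in> A" "h x \<in> topspace T" "in_filter A F"
  shows "F \<le> nhdsin (pullback_topology A h T) x \<longleftrightarrow> filtermap h F \<le> nhdsin T (h x)"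
proof -
  have x: "x \<in> topspace (pullback_topology A h T)"
    using assms by (simp add: topspace_pullback_topology)
  have "in_filter (h -` U \<inter> A) F \<longleftrightarrow> in_filter U (filtermap h F)" for U
    using assms(3) by (simp add: eventually_filtermap eventually_conj_iff)
  then show ?thesis
    unfolding le_nhdsin_iff[OF x] le_nhdsin_iff[OF assms(2)] openin_pullback_topology
    using assms(1) by blast
qed

text \<open>
  A homeomorphism onto a topological convergence pulls the topology back to one that induces
  the given convergence.
\<close>

lemma topological_conv_if_homeomorphism:
  assumes Z: "convergence_space Z" and h: "conv_homeomorphism Z (conv_of_topology T) h"
  shows "topological_conv Z"
proof -
  let ?T = "pullback_topology (cpoints Z) h T"
  have hT: "h x \<in> topspace T" if "x \<in> cpoints Z" for x
    using h that
    by (auto simp: conv_homeomorphism_def bij_betw_def cpoints_conv_of_topology)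
  then have top: "topspace ?T = cpoints Z"
    by (auto simp: topspace_pullback_topology)
  have "x \<in> clim Z F \<longleftrightarrow> x \<in> clim (conv_of_topology ?T) F" for x F
  proof (cases "filter_on (cpoints Z) F \<and> x \<in> cpoints Z")
    case True
    then have F: "in_filter (cpoints Z) F"
      by (simp add: in_filter_carrier)
    then have "in_filter (topspace T) (filtermap h F)"
      using hT by (auto simp: eventually_filtermap elim: eventually_mono)
    then have "filter_on (topspace T) (filtermap h F)"
      using True by (simp add: filter_on_def le_principal filtermap_bot_iff)
    then have "x \<in> clim Z F \<longleftrightarrow> filtermap h F \<le> nhdsin T (h x)"
      using h True hT by (simp add: conv_homeomorphism_def clim_conv_of_topology)
    also have "\<dots> \<longleftrightarrow> F \<le> nhdsin ?T x"
      using True hT F by (simp add: le_nhdsin_pullback_topology)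
    finally show ?thesis
      using True by (simp add: clim_conv_of_topology top)
  next
    case False
    then show ?thesis
      using Z by (auto simp: convergence_space_def clim_conv_of_topology top)
  qed
  then have "Z = conv_of_topology ?T"
    by (intro convergence.equality) (auto simp: cpoints_conv_of_topology top)
  then show ?thesis
    by (auto simp: topological_conv_def)
qed

theorem proposition1:
  fixes X :: "'a topology"
  shows "core_compact (dual (conv_of_topology X)) \<and>
    topological_conv (dual (dual (conv_of_topology X))) \<and>
    (\<lambda>W. indicated (conv_of_topology X) ` W) ` {W. conv_open (dual (conv_of_topology X)) W} = kappa X \<and>
    conv_homeomorphism (dual (dual (conv_of_topology X))) (conv_of_topology (stone_topology X))
      (bidual_family X)"
proof (intro conjI core_compact_opens bidual_homeomorphism)
  show "topological_conv (dual (opens X))"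
    using topological_conv_if_homeomorphism[OF _ bidual_homeomorphism]
    by (simp add: convergence_space_dual convergence_space_opens)
  show "(\<lambda>W. set_of X ` W) ` {W. conv_open (opens X) W} = kappa X"
    using bij_betw_conv_open_kappa by (rule bij_betw_imp_surj_on)
qed

end
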